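(* Let $\Delta\neq\mathbb{N}$ be a numerical semigroup and let $d\ge2$ be an integer. Let $x\in\Delta$ with $\gcd(x,d)=1$, and set $S=\langle x\rangle+d\Delta$. Then $\operatorname{t}(S)=\operatorname{t}(\Delta)$ and $$\operatorname{PF}(S)=\{df+(d-1)x: f\in\operatorname{PF}(\Delta)\}.$$ In particular, $S$ is symmetric if and only if $\Delta$ is symmetric.
   Context: $\mathbb{N}=\{0,1,2,\dots\}$. A numerical semigroup is a submonoid of $(\mathbb{N},+)$ with finite complement in $\mathbb{N}$. For a numerical semigroup $S$: $\operatorname{F}(S)=\max(\mathbb{Z}\setminus S)$; $\operatorname{PF}(S)=\{y\in\mathbb{Z}\setminus S: y+s\in S\text{ for all }s\in S\setminus\{0\}\}$ is the set of pseudo-Frobenius numbers; $\operatorname{t}(S)=|\operatorname{PF}(S)|$ is the type; $S$ is symmetric if $y\notin S$ implies $\operatorname{F}(S)-y\in S$ for all $y\in\mathbb{Z}$ (equivalently $\operatorname{PF}(S)=\{\operatorname{F}(S)\}$). $\langle x\rangle=\{kx:k\in\mathbb{N}\}$, $d\Delta=\{d\delta:\delta\in\Delta\}$, and $A+B=\{a+b:a\in A,b\in B\}$. Under the stated hypotheses $S$ is a numerical semigroup. *)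

theory Defs
  imports "HOL-Library.Set_Algebras" "HOL-Number_Theory.Cong"
begin

text \<open>
  Numerical semigroups are sets of natural numbers; since the Frobenius number and the
  pseudo-Frobenius numbers live in \<^typ>\<open>int\<close> (they are \<open>-1\<close> for the semigroup of all natural
  numbers), complements are formed in \<^typ>\<open>int\<close> via \<open>int ` S\<close>.
\<close>

definition numerical_semigroup :: "nat set \<Rightarrow> bool" where
  "numerical_semigroup S \<longleftrightarrow>
     0 \<in> S \<and> (\<forall>a\<in>S. \<forall>b\<in>S. a + b \<in> S) \<and> finite (- S)"

text \<open>
  The complement of a numerical semigroup in the integers is infinite but has a greatest element;
  \<^const>\<open>Max\<close> is only specified on finite sets.
\<close>

definition frobenius :: "nat set \<Rightarrow> int" where
  "frobenius S = (GREATEST y. y \<in> - (int ` S))"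

definition pseudo_frobenius :: "nat set \<Rightarrow> int set" where
  "pseudo_frobenius S = {y. y \<notin> int ` S \<and> (\<forall>s\<in>S - {0}. y + int s \<in> int ` S)}"

definition semigroup_type :: "nat set \<Rightarrow> nat" where
  "semigroup_type S = card (pseudo_frobenius S)"

definition symmetric_semigroup :: "nat set \<Rightarrow> bool" where
  "symmetric_semigroup S \<longleftrightarrow> (\<forall>y. y \<notin> int ` S \<longrightarrow> frobenius S - y \<in> int ` S)"

definition multiples :: "nat \<Rightarrow> nat set" where
  "multiples x = {k * x | k. True}"

lemma frobenius_greatest:
  assumes "numerical_semigroup S"
  shows "frobenius S \<notin> int ` S" and "y \<notin> int ` S \<Longrightarrow> y \<le> frobenius S"
proof -
  let ?P = "\<lambda>y. y \<in> - (int ` S)"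
  have fin: "finite (int ` (- S) \<union> {-1})"
    using assms by (simp add: numerical_semigroup_def)
  define m where "m = Max (int ` (- S) \<union> {-1})"
  have "m \<in> int ` (- S) \<union> {-1}"
    unfolding m_def using fin by (intro Max_in) auto
  then have m: "?P m" by auto
  have le: "y \<le> m" if "?P y" for y
  proof (cases "y \<ge> 0")
    case True
    then have "y = int (nat y)" by simp
    with that have "y \<in> int ` (- S)" by (metis ComplD ComplI imageI)
    then show ?thesis unfolding m_def using fin by (intro Max_ge) auto
  next
    case False
    moreover have "-1 \<le> m" unfolding m_def using fin by (intro Max_ge) auto
    ultimately show ?thesis by simp
  qed
  have "frobenius S = m"
    unfolding frobenius_def by (rule Greatest_equality) (use m le in auto)
  with m le show "frobenius S \<notin> int ` S" and "y \<notin> int ` S \<Longrightarrow> y \<le> frobenius S" by auto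
qed

lemma numerical_semigroup_glue:
  assumes D: "numerical_semigroup D" and d: "d > 0" and cop: "gcd x d = 1"
  shows "numerical_semigroup (multiples x + d *o D)"
proof -
  let ?S = "multiples x + d *o D"
  have mem: "n \<in> ?S \<longleftrightarrow> (\<exists>k. \<exists>e\<in>D. n = k * x + d * e)" for n
    by (auto simp: set_plus_def elt_set_times_def multiples_def)
  have D0: "0 \<in> D" and Dadd: "\<And>a b. a \<in> D \<Longrightarrow> b \<in> D \<Longrightarrow> a + b \<in> D"
    and fin: "finite (- D)"
    using D by (auto simp: numerical_semigroup_def)
  have zero: "0 \<in> ?S" using D0 mem by (metis add_0 mult_0 mult_0_right)
  have add: "a + b \<in> ?S" if a: "a \<in> ?S" and b: "b \<in> ?S" for a b
  proof -
    obtain k e where 1: "e \<in> D" "a = k * x + d * e" using a mem by auto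
    obtain l f where 2: "f \<in> D" "b = l * x + d * f" using b mem by auto
    have "a + b = (k + l) * x + d * (e + f)" using 1 2 by (simp add: algebra_simps)
    with Dadd[OF 1(1) 2(1)] show ?thesis using mem by blast
  qed
  obtain c where c: "\<And>n. n \<in> - D \<Longrightarrow> n < c"
    using fin finite_nat_set_iff_bounded by auto
  have "n \<in> ?S" if n: "n \<ge> d * x + d * c" for n
  proof -
    have "coprime x d" using cop by (simp add: coprime_iff_gcd_eq_1)
    then obtain u where u: "[x * u = 1] (mod d)" using cong_solve_coprime_nat by (metis One_nat_def)
    define a where "a = (u * n) mod d"
    have "[a * x = u * n * x] (mod d)"
      unfolding a_def by (intro cong_mult) auto
    also have "u * n * x = (x * u) * n" by simp
    also have "[(x * u) * n = 1 * n] (mod d)" by (intro cong_mult u) auto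
    finally have "[n = a * x] (mod d)" by (simp add: cong_sym)
    moreover have le: "a * x \<le> d * x"
      unfolding a_def using d by (intro mult_le_mono1) (simp add: less_imp_le)
    then have "a * x \<le> n" using n by linarith
    ultimately have "d dvd n - a * x" by (simp add: cong_altdef_nat)
    then obtain e where e: "n - a * x = d * e" by auto
    with le n have "d * c \<le> d * e" by linarith
    then have "c \<le> e" using d by simp
    then have "e \<in> D" using c by fastforce
    moreover have "n = a * x + d * e" using e le n by linarith
    ultimately show ?thesis using mem by blast
  qed
  then have "- ?S \<subseteq> {..< d * x + d * c}" by (metis ComplD lessThan_iff not_le subsetI)
  then have "finite (- ?S)" using finite_subset by blast
  with zero add show ?thesis unfolding numerical_semigroup_def by blast
qed

end

theory Submission
  imports Defs
begin

text \<open>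
  Since \<open>gcd x d = 1\<close>, every integer is uniquely of the form \<open>a x + d z\<close> with \<open>0 \<le> a < d\<close>, and
  since \<open>x \<in> \<Delta>\<close> it lies in \<open>S\<close> iff \<open>z \<in> \<Delta>\<close>. For \<open>a < d - 1\<close> adding \<open>x\<close> does not change \<open>z\<close>,
  so a pseudo-Frobenius number of \<open>S\<close> has \<open>a = d - 1\<close>. The reflection \<open>y \<mapsto> F(S) - y\<close> becomes
  \<open>(a, z) \<mapsto> (d - 1 - a, F(\<Delta>) - z)\<close>, which transfers symmetry.
\<close>

lemma int_mem_glue_iff:
  "y \<in> int ` (multiples x + d *o D) \<longleftrightarrow> (\<exists>k. \<exists>e\<in>D. y = int k * int x + int d * int e)"
proof -
  have "multiples x + d *o D = {k * x + d * e | k e. e \<in> D}"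
    by (auto simp: set_plus_def elt_set_times_def multiples_def)
  then show ?thesis by (fastforce simp: image_iff)
qed

text \<open>Here \<open>k\<close> need not be below \<open>d\<close>, and \<open>e\<close> is an
  integer, so that sums such as \<open>f + int s\<close> with \<open>f\<close> possibly negative can
  be inserted directly.\<close>

lemma glue_intI:
  "e \<in> int ` D \<Longrightarrow> int k * int x + int d * e \<in> int ` (multiples x + d *o D)"
  unfolding int_mem_glue_iff by auto

text \<open>This absorbs the carry when a coefficient of \<open>x\<close> is reduced modulo
  \<open>d\<close>: \<open>d\<close> copies of \<open>x\<close> turn into one extra \<open>x\<close>
  inside \<open>D\<close>.\<close>

lemma numerical_semigroup_add_multiple:
  assumes "numerical_semigroup D" "x \<in> D" "e \<in> D"
  shows "e + q * x \<in> D"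
proof (induction q)
  case (Suc q)
  then have "(e + q * x) + x \<in> D" using assms by (simp add: numerical_semigroup_def)
  then show ?case by (simp add: ac_simps)
qed (simp add: assms)

lemma residue_decomposition:
  fixes y :: int
  assumes "d > 0" "gcd x d = 1"
  obtains a z where "a < d" "y = int a * int x + int d * z"
proof -
  have "coprime (int x) (int d)"
    using assms(2) by (simp add: coprime_iff_gcd_eq_1)
  then obtain u where u: "[int x * u = 1] (mod int d)"
    using cong_solve_coprime_int by blast
  \<comment> \<open>With \<open>u\<close> inverse to \<open>x\<close> modulo \<open>d\<close>, the
    residue of \<open>u * y\<close> is the only candidate for the coefficient of
    \<open>x\<close>.\<close>
  define a where "a = nat ((u * y) mod int d)"
  have a: "int a = (u * y) mod int d" using assms(1) by (simp add: a_def)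
  have "[int a * int x = u * y * int x] (mod int d)"
    unfolding a by (intro cong_mult) auto
  also have "u * y * int x = (int x * u) * y" by simp
  also have "[(int x * u) * y = 1 * y] (mod int d)" by (intro cong_mult u) auto
  finally have "[y = int a * int x] (mod int d)" by (simp add: cong_sym)
  then obtain z where "y - int a * int x = int d * z"
    by (auto simp: cong_iff_dvd_diff)
  moreover have "int a < int d" unfolding a using assms(1) by simp
  ultimately show thesis using that[of a z] by (simp add: algebra_simps)
qed

text \<open>Coprimality forces the coefficient of \<open>x\<close> in any other representation to be
  congruent to \<open>a\<close> modulo \<open>d\<close>. As \<open>a < d\<close>, it is
  \<open>a + d * q\<close> with a natural number \<open>q\<close>, so \<open>z\<close> arises from
  an element of \<open>D\<close> by adding \<open>q * x\<close>.\<close>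

lemma glue_normal_form_iff:
  assumes D: "numerical_semigroup D" and x: "x \<in> D" and cop: "gcd x d = 1" and a: "a < d"
  shows "int a * int x + int d * z \<in> int ` (multiples x + d *o D) \<longleftrightarrow> z \<in> int ` D"
proof
  assume "int a * int x + int d * z \<in> int ` (multiples x + d *o D)"
  then obtain k e where e: "e \<in> D"
    and eq: "int a * int x + int d * z = int k * int x + int d * int e"
    unfolding int_mem_glue_iff by blast
  have "(int k - int a) * int x = int d * (z - int e)" using eq by (simp add: algebra_simps)
  then have "int d dvd (int k - int a) * int x" by simp
  moreover have "coprime (int d) (int x)"
    using cop by (simp add: coprime_iff_gcd_eq_1 gcd.commute)
  ultimately have "int d dvd int k - int a" by (simp add: coprime_dvd_mult_left_iff)
  then have "[int k = int a] (mod int d)" by (simp add: cong_iff_dvd_diff)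
  then have "[k = a] (mod d)" by (simp only: cong_int_iff)
  then have "k mod d = a" using a by (simp add: cong_def)
  then have k: "k = a + d * (k div d)" by (metis mod_mult_div_eq)
  have "int d * z = int d * (int e + int (k div d) * int x)"
    using eq arg_cong[OF k, of int] by (simp add: algebra_simps)
  then have "z = int (e + k div d * x)" using a by simp
  with numerical_semigroup_add_multiple[OF D x e] show "z \<in> int ` D" by blast
qed (rule glue_intI)

lemma pseudo_frobenius_glue:
  assumes D: "numerical_semigroup D" and x: "x \<in> D" and cop: "gcd x d = 1" and d: "d \<ge> 2"
  shows "pseudo_frobenius (multiples x + d *o D) =
    (\<lambda>f. int d * f + (int d - 1) * int x) ` pseudo_frobenius D"
    (is "pseudo_frobenius ?S = ?g ` _")
proof (intro subset_antisym subsetI)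
  note nf = glue_normal_form_iff[OF D x cop]
  \<comment> \<open>Otherwise the gcd would be \<open>d\<close>, which is at least 2.\<close>
  have x0: "x \<noteq> 0" using cop d by (cases "x = 0") auto
  have D0: "0 \<in> D" using D by (simp add: numerical_semigroup_def)
  {
    fix y assume y: "y \<in> pseudo_frobenius ?S"
    obtain a z where a: "a < d" and yeq: "y = int a * int x + int d * z"
      using residue_decomposition[of d x y] cop d by auto
    have PF: "y + int s \<in> int ` ?S" if "int s \<in> int ` ?S" "s \<noteq> 0" for s
      using y that by (auto simp: pseudo_frobenius_def)
    have z: "z \<notin> int ` D"
      using y nf[OF a] by (simp add: pseudo_frobenius_def yeq)
    \<comment> \<open>Test \<open>y\<close> against the element \<open>x\<close>: if
      \<open>Suc a < d\<close>, the sum is still in normal form with the same \<open>z\<close>,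
      which would put \<open>z\<close> in \<open>D\<close>.\<close>
    have "int x \<in> int ` ?S" using glue_intI[of 0 D 1 x d] D0 by simp
    then have "y + int x \<in> int ` ?S" using PF x0 by blast
    then have "int (Suc a) * int x + int d * z \<in> int ` ?S"
      by (simp add: yeq algebra_simps)
    then have "\<not> Suc a < d" using nf z by blast
    then have ad: "int a = int d - 1" using a by simp
    have "z + int s \<in> int ` D" if s: "s \<in> D" "s \<noteq> 0" for s
    proof -
      \<comment> \<open>The elements \<open>d * s\<close> shift only \<open>z\<close>, so they
        transfer the defining condition from \<open>y\<close> to \<open>z\<close>.\<close>
      have "int (d * s) \<in> int ` ?S" using glue_intI[of "int s" D 0 x d] s by simp
      moreover have "d * s \<noteq> 0" using s d by simp
      ultimately have "y + int (d * s) \<in> int ` ?S" by (rule PF)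
      then have "int a * int x + int d * (z + int s) \<in> int ` ?S"
        by (simp add: yeq algebra_simps)
      then show ?thesis using nf[OF a] by blast
    qed
    with z have "z \<in> pseudo_frobenius D" by (simp add: pseudo_frobenius_def)
    moreover have "y = ?g z" unfolding yeq ad by simp
    ultimately show "y \<in> ?g ` pseudo_frobenius D" by blast
  next
    fix y assume "y \<in> ?g ` pseudo_frobenius D"
    then obtain f where y: "y = ?g f" and f: "f \<in> pseudo_frobenius D" by blast
    have fD: "f \<notin> int ` D" and PF: "\<And>s. s \<in> D \<Longrightarrow> s \<noteq> 0 \<Longrightarrow> f + int s \<in> int ` D"
      using f by (auto simp: pseudo_frobenius_def)
    have yeq: "y = int (d - 1) * int x + int d * f"
      using d by (simp add: y of_nat_diff)
    have "y \<notin> int ` ?S" unfolding yeq using nf[of "d - 1" f] fD d by simp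
    moreover have "y + int s \<in> int ` ?S" if s: "s \<in> ?S - {0}" for s
    proof -
      obtain k e where e: "e \<in> D" and seq: "int s = int k * int x + int d * int e"
        using s int_mem_glue_iff[of "int s" x d D] by auto
      show ?thesis
      proof (cases k)
        case 0
        \<comment> \<open>Here \<open>e = 0\<close> would give \<open>s = 0\<close>, which is
          excluded.\<close>
        then have "f + int e \<in> int ` D" using PF e s seq by (cases "e = 0") auto
        then have "int (d - 1) * int x + int d * (f + int e) \<in> int ` ?S" by (rule glue_intI)
        then show ?thesis by (simp add: yeq seq 0 algebra_simps)
      next
        case (Suc j)
        \<comment> \<open>One copy of \<open>x\<close> from \<open>s\<close> completes
          \<open>(d - 1) * x\<close> to \<open>d * x\<close>. This moves into the second coordinate,
          where \<open>e + x\<close> is a nonzero element of \<open>D\<close> even if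
          \<open>e = 0\<close>.\<close>
        have "e + x \<in> D" using D e x by (simp add: numerical_semigroup_def)
        moreover have "e + x \<noteq> 0" using x0 by simp
        ultimately have "f + int (e + x) \<in> int ` D" by (rule PF)
        then have "int j * int x + int d * (f + int (e + x)) \<in> int ` ?S" by (rule glue_intI)
        then show ?thesis by (simp add: y seq Suc algebra_simps)
      qed
    qed
    ultimately show "y \<in> pseudo_frobenius ?S" by (simp add: pseudo_frobenius_def)
  }
qed

text \<open>Among the gaps \<open>a * x + d * z\<close> with \<open>a < d\<close> and
  \<open>z\<close> a gap of \<open>D\<close>, both coordinates can be maximised
  independently.\<close>

lemma frobenius_glue:
  assumes D: "numerical_semigroup D" and x: "x \<in> D" and cop: "gcd x d = 1" and d: "d > 0"
  shows "frobenius (multiples x + d *o D) = int (d - 1) * int x + int d * frobenius D"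
    (is "frobenius ?S = ?F")
proof (rule antisym)
  note nf = glue_normal_form_iff[OF D x cop]
  note S = numerical_semigroup_glue[OF D d cop]
  have "?F \<notin> int ` ?S" using nf[of "d - 1"] d frobenius_greatest(1)[OF D] by simp
  then show "?F \<le> frobenius ?S" by (rule frobenius_greatest(2)[OF S])
  obtain a z where a: "a < d" and eq: "frobenius ?S = int a * int x + int d * z"
    using residue_decomposition[OF d cop] by blast
  have "z \<notin> int ` D" using frobenius_greatest(1)[OF S] nf[OF a] eq by simp
  then have "z \<le> frobenius D" by (rule frobenius_greatest(2)[OF D])
  then show "frobenius ?S \<le> ?F"
    unfolding eq using a by (intro add_mono mult_right_mono mult_left_mono) auto
qed

lemma symmetric_semigroup_glue_iff:
  assumes D: "numerical_semigroup D" and x: "x \<in> D" and cop: "gcd x d = 1" and d: "d > 0"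
  shows "symmetric_semigroup (multiples x + d *o D) \<longleftrightarrow> symmetric_semigroup D"
    (is "symmetric_semigroup ?S \<longleftrightarrow> _")
proof -
  note nf = glue_normal_form_iff[OF D x cop]
  \<comment> \<open>The Frobenius number of \<open>?S\<close> has first coordinate
    \<open>d - 1\<close>, so subtraction leaves \<open>d - 1 - a\<close>, again between 0 and
    \<open>d - 1\<close>, and the normal form criterion applies.\<close>
  have reflect: "frobenius ?S - (int a * int x + int d * z) \<in> int ` ?S \<longleftrightarrow>
      frobenius D - z \<in> int ` D" if a: "a < d" for a z
  proof -
    have "frobenius ?S - (int a * int x + int d * z)
        = int (d - 1 - a) * int x + int d * (frobenius D - z)"
      using a by (simp add: frobenius_glue[OF assms] of_nat_diff algebra_simps)
    then show ?thesis using nf[of "d - 1 - a"] a by simp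
  qed
  show ?thesis
  proof
    assume S: "symmetric_semigroup ?S"
    show "symmetric_semigroup D"
      unfolding symmetric_semigroup_def
    proof (intro allI impI)
      fix z assume "z \<notin> int ` D"
      \<comment> \<open>A single residue class suffices to recover the symmetry of \<open>D\<close>;
        take \<open>a = 0\<close>.\<close>
      then have "int 0 * int x + int d * z \<notin> int ` ?S" using nf[OF d] by blast
      then show "frobenius D - z \<in> int ` D"
        using S reflect[OF d] unfolding symmetric_semigroup_def by blast
    qed
  next
    assume sym: "symmetric_semigroup D"
    show "symmetric_semigroup ?S"
      unfolding symmetric_semigroup_def
    proof (intro allI impI)
      fix y assume y: "y \<notin> int ` ?S"
      obtain a z where a: "a < d" and eq: "y = int a * int x + int d * z"
        using residue_decomposition[OF d cop] by blast
      show "frobenius ?S - y \<in> int ` ?S"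
        using y sym nf[OF a] reflect[OF a] unfolding eq symmetric_semigroup_def by blast
    qed
  qed
qed

theorem theorem4p15:
  fixes \<Delta> S :: "nat set" and d x :: nat
  assumes "numerical_semigroup \<Delta>"
    and "\<Delta> \<noteq> UNIV"
    and "d \<ge> 2"
    and "x \<in> \<Delta>"
    and "gcd x d = 1"
    and "S = multiples x + d *o \<Delta>"
  shows "semigroup_type S = semigroup_type \<Delta>
    \<and> pseudo_frobenius S =
        {int d * f + (int d - 1) * int x | f. f \<in> pseudo_frobenius \<Delta>}
    \<and> (symmetric_semigroup S \<longleftrightarrow> symmetric_semigroup \<Delta>)"
proof (intro conjI)
  let ?g = "\<lambda>f. int d * f + (int d - 1) * int x"
  have PF: "pseudo_frobenius S = ?g ` pseudo_frobenius \<Delta>"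
    using pseudo_frobenius_glue assms by simp
  then show "pseudo_frobenius S = {?g f | f. f \<in> pseudo_frobenius \<Delta>}" by auto
  have "inj_on ?g (pseudo_frobenius \<Delta>)" using assms(3) by (auto intro: inj_onI)
  then show "semigroup_type S = semigroup_type \<Delta>"
    unfolding semigroup_type_def PF by (rule card_image)
  show "symmetric_semigroup S \<longleftrightarrow> symmetric_semigroup \<Delta>"
    using symmetric_semigroup_glue_iff assms by simp
qed

end
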